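(* There exists a complete distributive lattice $D$ that is self-dual (isomorphic to its dual lattice), such that the center $\mathrm{Cen}\,D$ is a complete sublattice of $D$ and is atomistic, but $D$ is not totally decomposable.
   Context: An element $a$ of a lattice $L$ is neutral if $\{a,x,y\}$ generates a distributive sublattice of $L$ for all $x,y\in L$. In a bounded lattice $L$, an element is central if it is both neutral and complemented in $L$; $\mathrm{Cen}\,L$ denotes the set of all central elements of $L$, which is a Boolean sublattice of $L$. A complete sublattice of a complete lattice $L$ is a subset closed under arbitrary joins and meets computed in $L$ (including the empty ones). A lattice with zero is atomistic if each of its elements is a join of atoms (the empty join being $0$). A lattice is directly indecomposable if it is not isomorphic to a product of two lattices each having more than one element. A lattice is totally decomposable if it is isomorphic to a direct product $\prod_{i\in I}L_i$ (with $I$ an arbitrary set) where all the $L_i$ are directly indecomposable. *)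

theory Defs
  imports "HOL-Algebra.Complete_Lattice" "HOL-Library.FuncSet"
begin

section \<open>Distributive lattices, sublattices, neutral and central elements\<close>

locale distributive_lattice = lattice +
  assumes meet_join_distrib:
    "\<lbrakk>x \<in> carrier L; y \<in> carrier L; z \<in> carrier L\<rbrakk>
      \<Longrightarrow> x \<sqinter> (y \<squnion> z) = (x \<sqinter> y) \<squnion> (x \<sqinter> z)"

definition sublattice :: "'a gorder \<Rightarrow> 'a set \<Rightarrow> bool" where
  "sublattice L S \<longleftrightarrow> S \<subseteq> carrier L \<and>
    (\<forall>x\<in>S. \<forall>y\<in>S. x \<squnion>\<^bsub>L\<^esub> y \<in> S \<and> x \<sqinter>\<^bsub>L\<^esub> y \<in> S)"

definition generated_sublattice :: "'a gorder \<Rightarrow> 'a set \<Rightarrow> 'a set" where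
  "generated_sublattice L X = \<Inter>{S. sublattice L S \<and> X \<subseteq> S}"

definition neutral :: "'a gorder \<Rightarrow> 'a \<Rightarrow> bool" where
  "neutral L a \<longleftrightarrow> a \<in> carrier L \<and>
    (\<forall>x\<in>carrier L. \<forall>y\<in>carrier L.
      distributive_lattice (L\<lparr>carrier := generated_sublattice L {a, x, y}\<rparr>))"

definition complemented :: "'a gorder \<Rightarrow> 'a \<Rightarrow> bool" where
  "complemented L a \<longleftrightarrow> a \<in> carrier L \<and>
    (\<exists>b\<in>carrier L. a \<squnion>\<^bsub>L\<^esub> b = \<top>\<^bsub>L\<^esub> \<and> a \<sqinter>\<^bsub>L\<^esub> b = \<bottom>\<^bsub>L\<^esub>)"

definition Cen :: "'a gorder \<Rightarrow> 'a set" where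
  "Cen L = {a. neutral L a \<and> complemented L a}"

definition complete_sublattice :: "'a gorder \<Rightarrow> 'a set \<Rightarrow> bool" where
  "complete_sublattice L S \<longleftrightarrow> S \<subseteq> carrier L \<and>
    (\<forall>A. A \<subseteq> S \<longrightarrow> \<Squnion>\<^bsub>L\<^esub>A \<in> S \<and> \<Sqinter>\<^bsub>L\<^esub>A \<in> S)"


section \<open>Atomistic lattices\<close>

definition atom :: "'a gorder \<Rightarrow> 'a \<Rightarrow> bool" where
  "atom L a \<longleftrightarrow> a \<in> carrier L \<and> a \<noteq> \<bottom>\<^bsub>L\<^esub> \<and>
    (\<forall>x\<in>carrier L. x \<sqsubseteq>\<^bsub>L\<^esub> a \<longrightarrow> x = \<bottom>\<^bsub>L\<^esub> \<or> x = a)"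

text \<open>The second conjunct says that the lattice has a zero. Arbitrary joins need not exist, hence
  the use of \<^const>\<open>least\<close>; for \<open>A = {}\<close> it says that \<open>x\<close> is the zero.\<close>

definition atomistic :: "'a gorder \<Rightarrow> bool" where
  "atomistic L \<longleftrightarrow> lattice L \<and> (\<exists>z. least L z (carrier L)) \<and>
    (\<forall>x\<in>carrier L. \<exists>A. A \<subseteq> {a. atom L a} \<and> is_lub L x A)"


section \<open>Isomorphism and direct products\<close>

text \<open>\<^const>\<open>join_pres\<close> and \<^const>\<open>meet_pres\<close> include that both structures are lattices.\<close>

definition lattice_isomorphic :: "'a gorder \<Rightarrow> 'b gorder \<Rightarrow> bool" where
  "lattice_isomorphic L M \<longleftrightarrow>
    (\<exists>f. bij_betw f (carrier L) (carrier M) \<and> join_pres L M f \<and> meet_pres L M f)"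

definition binary_product :: "'a gorder \<Rightarrow> 'b gorder \<Rightarrow> ('a \<times> 'b) gorder" where
  "binary_product A B =
    \<lparr>carrier = carrier A \<times> carrier B, eq = (=),
     le = (\<lambda>x y. fst x \<sqsubseteq>\<^bsub>A\<^esub> fst y \<and> snd x \<sqsubseteq>\<^bsub>B\<^esub> snd y)\<rparr>"

definition direct_product :: "'i set \<Rightarrow> ('i \<Rightarrow> 'a gorder) \<Rightarrow> ('i \<Rightarrow> 'a) gorder" where
  "direct_product I F =
    \<lparr>carrier = (\<Pi>\<^sub>E i\<in>I. carrier (F i)), eq = (=),
     le = (\<lambda>x y. \<forall>i\<in>I. x i \<sqsubseteq>\<^bsub>F i\<^esub> y i)\<rparr>"

definition more_than_one_element :: "'a gorder \<Rightarrow> bool" where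
  "more_than_one_element L \<longleftrightarrow> (\<exists>x\<in>carrier L. \<exists>y\<in>carrier L. x \<noteq> y)"

text \<open>HOL cannot quantify over types inside a formula, so in the next two definitions the carriers
  of the factors and the index set live in the type of the given lattice. This loses nothing: the
  lemmas \<open>directly_indecomposable_any_type\<close> and \<open>totally_decomposable_any_type\<close> below
  allow arbitrary types for them.\<close>

definition directly_indecomposable :: "'a gorder \<Rightarrow> bool" where
  "directly_indecomposable L \<longleftrightarrow> lattice L \<and>
    \<not> (\<exists>(A :: 'a gorder) (B :: 'a gorder). lattice A \<and> lattice B \<and>
        more_than_one_element A \<and> more_than_one_element B \<and>
        lattice_isomorphic L (binary_product A B))"

definition totally_decomposable :: "'a gorder \<Rightarrow> bool" where
  "totally_decomposable L \<longleftrightarrow>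
    (\<exists>(I :: 'a set) (F :: 'a \<Rightarrow> 'a gorder).
      (\<forall>i\<in>I. directly_indecomposable (F i)) \<and> lattice_isomorphic L (direct_product I F))"


section \<open>Independence of the types of the factors and of the index set\<close>

definition order_iso :: "('a \<Rightarrow> 'b) \<Rightarrow> 'a gorder \<Rightarrow> 'b gorder \<Rightarrow> bool" where
  "order_iso f L M \<longleftrightarrow> bij_betw f (carrier L) (carrier M) \<and>
    (\<forall>x\<in>carrier L. \<forall>y\<in>carrier L. x \<sqsubseteq>\<^bsub>L\<^esub> y \<longleftrightarrow> f x \<sqsubseteq>\<^bsub>M\<^esub> f y)"

lemma order_iso_sym:
  assumes "order_iso f L M"
  shows "order_iso (inv_into (carrier L) f) M L"
proof -
  let ?g = "inv_into (carrier L) f"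
  have b: "bij_betw f (carrier L) (carrier M)"
    and le: "\<And>x y. \<lbrakk>x \<in> carrier L; y \<in> carrier L\<rbrakk> \<Longrightarrow> x \<sqsubseteq>\<^bsub>L\<^esub> y \<longleftrightarrow> f x \<sqsubseteq>\<^bsub>M\<^esub> f y"
    using assms by (auto simp: order_iso_def)
  have "?g x \<in> carrier L" "f (?g x) = x" if "x \<in> carrier M" for x
    using b that by (auto simp: bij_betw_def inv_into_into f_inv_into_f)
  then show ?thesis
    unfolding order_iso_def using le bij_betw_inv_into[OF b] by metis
qed

lemma order_iso_trans:
  assumes "order_iso f L M" "order_iso g M N"
  shows "order_iso (g \<circ> f) L N"
  using assms unfolding order_iso_def by (auto intro: bij_betw_trans simp: bij_betwE)

lemma order_iso_is_lub:
  assumes f: "order_iso f L M" and A: "A \<subseteq> carrier L" and x: "is_lub L x A"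
  shows "is_lub M (f x) (f ` A)"
proof -
  have im: "carrier M = f ` carrier L" using f by (simp add: order_iso_def bij_betw_def)
  have "x \<in> carrier L" "\<And>a. a \<in> A \<Longrightarrow> a \<sqsubseteq>\<^bsub>L\<^esub> x"
    "\<And>y. y \<in> carrier L \<Longrightarrow> (\<And>a. a \<in> A \<Longrightarrow> a \<sqsubseteq>\<^bsub>L\<^esub> y) \<Longrightarrow> x \<sqsubseteq>\<^bsub>L\<^esub> y"
    using x A by (auto simp: least_def Upper_def)
  then show ?thesis
    using f A unfolding order_iso_def least_def Upper_def im by (auto simp: subset_iff)
qed

lemma order_iso_is_glb:
  assumes f: "order_iso f L M" and A: "A \<subseteq> carrier L" and x: "is_glb L x A"
  shows "is_glb M (f x) (f ` A)"
proof -
  have im: "carrier M = f ` carrier L" using f by (simp add: order_iso_def bij_betw_def)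
  have "x \<in> carrier L" "\<And>a. a \<in> A \<Longrightarrow> x \<sqsubseteq>\<^bsub>L\<^esub> a"
    "\<And>y. y \<in> carrier L \<Longrightarrow> (\<And>a. a \<in> A \<Longrightarrow> y \<sqsubseteq>\<^bsub>L\<^esub> a) \<Longrightarrow> y \<sqsubseteq>\<^bsub>L\<^esub> x"
    using x A by (auto simp: greatest_def Lower_def)
  then show ?thesis
    using f A unfolding order_iso_def greatest_def Lower_def im by (auto simp: subset_iff)
qed

lemma partial_orderI:
  assumes "eq L = (=)" "\<And>x. x \<in> carrier L \<Longrightarrow> x \<sqsubseteq>\<^bsub>L\<^esub> x"
    "\<And>x y. \<lbrakk>x \<in> carrier L; y \<in> carrier L; x \<sqsubseteq>\<^bsub>L\<^esub> y; y \<sqsubseteq>\<^bsub>L\<^esub> x\<rbrakk> \<Longrightarrow> x = y"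
    "\<And>x y z. \<lbrakk>x \<in> carrier L; y \<in> carrier L; z \<in> carrier L; x \<sqsubseteq>\<^bsub>L\<^esub> y; y \<sqsubseteq>\<^bsub>L\<^esub> z\<rbrakk> \<Longrightarrow> x \<sqsubseteq>\<^bsub>L\<^esub> z"
  shows "partial_order L"
proof -
  have "equivalence L"
    by unfold_locales (simp_all add: assms(1))
  moreover have "weak_partial_order_axioms L"
  proof (rule weak_partial_order_axioms.intro)
    fix x y z w
    show "x \<sqsubseteq>\<^bsub>L\<^esub> x" if "x \<in> carrier L" using that by (rule assms(2))
    show "x .=\<^bsub>L\<^esub> y" if "x \<sqsubseteq>\<^bsub>L\<^esub> y" "y \<sqsubseteq>\<^bsub>L\<^esub> x" "x \<in> carrier L" "y \<in> carrier L"
      unfolding assms(1) using that(3,4,1,2) by (rule assms(3))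
    show "x \<sqsubseteq>\<^bsub>L\<^esub> z" if "x \<sqsubseteq>\<^bsub>L\<^esub> y" "y \<sqsubseteq>\<^bsub>L\<^esub> z"
      "x \<in> carrier L" "y \<in> carrier L" "z \<in> carrier L"
      using that(3,4,5,1,2) by (rule assms(4))
    show "x \<sqsubseteq>\<^bsub>L\<^esub> z \<longleftrightarrow> y \<sqsubseteq>\<^bsub>L\<^esub> w" if "x .=\<^bsub>L\<^esub> y" "z .=\<^bsub>L\<^esub> w"
      using that by (simp add: assms(1))
  qed
  ultimately show ?thesis
    by (intro partial_order.intro weak_partial_order.intro partial_order_axioms.intro assms(1))
qed

lemma latticeI:
  assumes "partial_order L"
    "\<And>x y. \<lbrakk>x \<in> carrier L; y \<in> carrier L\<rbrakk> \<Longrightarrow> \<exists>s. is_lub L s {x, y}"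
    "\<And>x y. \<lbrakk>x \<in> carrier L; y \<in> carrier L\<rbrakk> \<Longrightarrow> \<exists>s. is_glb L s {x, y}"
  shows "lattice L"
proof -
  interpret partial_order L by fact
  show ?thesis by unfold_locales (use assms in auto)
qed

lemma lattice_is_lub_join:
  assumes "lattice L" "x \<in> carrier L" "y \<in> carrier L"
  shows "is_lub L (x \<squnion>\<^bsub>L\<^esub> y) {x, y}"
proof -
  interpret lattice L by fact
  show ?thesis by (rule joinI[OF _ assms(2,3)])
qed

lemma lattice_is_glb_meet:
  assumes "lattice L" "x \<in> carrier L" "y \<in> carrier L"
  shows "is_glb L (x \<sqinter>\<^bsub>L\<^esub> y) {x, y}"
proof -
  interpret lattice L by fact
  show ?thesis by (rule meetI[OF _ assms(2,3)])
qed

lemma lattice_partial_order: "lattice L \<Longrightarrow> partial_order L"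
  by (simp add: lattice_def upper_semilattice_def)

lemma order_iso_lattice:
  assumes f: "order_iso f L M" and L: "lattice L" and M: "partial_order M"
  shows "lattice M"
proof (rule latticeI[OF M])
  have im: "carrier M = f ` carrier L" using f by (simp add: order_iso_def bij_betw_def)
  fix x y assume "x \<in> carrier M" "y \<in> carrier M"
  then obtain u v where uv: "u \<in> carrier L" "v \<in> carrier L" "x = f u" "y = f v"
    by (auto simp: im)
  show "\<exists>s. is_lub M s {x, y}"
    using order_iso_is_lub[OF f _ lattice_is_lub_join[OF L uv(1,2)]] uv by auto
  show "\<exists>s. is_glb M s {x, y}"
    using order_iso_is_glb[OF f _ lattice_is_glb_meet[OF L uv(1,2)]] uv by auto
qed

lemma lattice_isomorphicD:
  assumes "lattice_isomorphic L M"
  shows "lattice L" "lattice M" "\<exists>f. order_iso f L M"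
proof -
  obtain f where b: "bij_betw f (carrier L) (carrier M)"
    and j: "join_pres L M f" using assms by (auto simp: lattice_isomorphic_def)
  show L: "lattice L" and M: "lattice M" using j by (auto simp: join_pres_def)
  have "x \<sqsubseteq>\<^bsub>L\<^esub> y \<longleftrightarrow> f x \<sqsubseteq>\<^bsub>M\<^esub> f y" if xy: "x \<in> carrier L" "y \<in> carrier L" for x y
  proof -
    have c: "f z \<in> carrier M" if "z \<in> carrier L" for z
      using b that by (rule bij_betw_apply)
    have cl: "x \<squnion>\<^bsub>L\<^esub> y \<in> carrier L"
      using lattice_is_lub_join[OF L xy] by (rule least_closed)
    have "x \<sqsubseteq>\<^bsub>L\<^esub> y \<longleftrightarrow> x \<squnion>\<^bsub>L\<^esub> y = y"
      by (rule lattice.le_iff_meet[OF L xy])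
    also have "\<dots> \<longleftrightarrow> f (x \<squnion>\<^bsub>L\<^esub> y) = f y"
      using b cl xy by (auto simp: bij_betw_def inj_on_eq_iff)
    also have "\<dots> \<longleftrightarrow> f x \<squnion>\<^bsub>M\<^esub> f y = f y"
      using j xy by (simp add: join_pres_def)
    also have "\<dots> \<longleftrightarrow> f x \<sqsubseteq>\<^bsub>M\<^esub> f y"
      by (rule lattice.le_iff_meet[OF M c c, symmetric]) (rule xy)+
    finally show ?thesis .
  qed
  then show "\<exists>f. order_iso f L M" using b by (auto simp: order_iso_def)
qed

lemma lattice_isomorphicI:
  assumes f: "order_iso f L M" and L: "lattice L" and M: "partial_order M"
  shows "lattice_isomorphic L M"
proof -
  have lM: "lattice M" by (rule order_iso_lattice[OF assms])
  have c: "f x \<in> carrier M" if "x \<in> carrier L" for x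
    using f that by (auto simp: order_iso_def bij_betwE)
  have "f (x \<squnion>\<^bsub>L\<^esub> y) = f x \<squnion>\<^bsub>M\<^esub> f y" if xy: "x \<in> carrier L" "y \<in> carrier L" for x y
    using order_iso_is_lub[OF f _ lattice_is_lub_join[OF L xy]] xy
      lattice_is_lub_join[OF lM c[OF xy(1)] c[OF xy(2)]]
    by (auto intro: partial_order.least_unique[OF M])
  moreover have "f (x \<sqinter>\<^bsub>L\<^esub> y) = f x \<sqinter>\<^bsub>M\<^esub> f y"
    if xy: "x \<in> carrier L" "y \<in> carrier L" for x y
    using order_iso_is_glb[OF f _ lattice_is_glb_meet[OF L xy]] xy
      lattice_is_glb_meet[OF lM c[OF xy(1)] c[OF xy(2)]]
    by (auto intro: partial_order.greatest_unique[OF M])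
  ultimately show ?thesis
    using f L lM unfolding lattice_isomorphic_def join_pres_def meet_pres_def order_iso_def
    by blast
qed

lemma lattice_isomorphic_sym:
  "lattice_isomorphic L M \<Longrightarrow> lattice_isomorphic M L"
  by (meson lattice_isomorphicD lattice_isomorphicI lattice_partial_order order_iso_sym)

lemma lattice_isomorphic_trans:
  "lattice_isomorphic L M \<Longrightarrow> lattice_isomorphic M N \<Longrightarrow> lattice_isomorphic L N"
  by (meson lattice_isomorphicD lattice_isomorphicI lattice_partial_order order_iso_trans)

definition order_copy :: "('a \<Rightarrow> 'b) \<Rightarrow> 'a gorder \<Rightarrow> 'b gorder" where
  "order_copy f L = \<lparr>carrier = f ` carrier L, eq = (=),
    le = (\<lambda>x y. inv_into (carrier L) f x \<sqsubseteq>\<^bsub>L\<^esub> inv_into (carrier L) f y)\<rparr>"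

lemma order_copy:
  assumes L: "lattice L" and inj: "inj_on f (carrier L)"
  shows "order_iso f L (order_copy f L)" "lattice (order_copy f L)"
    "lattice_isomorphic L (order_copy f L)"
proof -
  interpret lattice L by fact
  show 1: "order_iso f L (order_copy f L)"
    using inj by (auto simp: order_iso_def order_copy_def bij_betw_def)
  have 2: "partial_order (order_copy f L)"
    by (rule partial_orderI) (use inj in \<open>auto simp: order_copy_def intro: le_trans dest: le_antisym\<close>)
  show "lattice (order_copy f L)" "lattice_isomorphic L (order_copy f L)"
    using order_iso_lattice[OF 1 L 2] lattice_isomorphicI[OF 1 L 2] by auto
qed

lemma binary_product_partial_order:
  assumes "partial_order A" "partial_order B"
  shows "partial_order (binary_product A B)"
proof -
  interpret A: partial_order A by fact
  interpret B: partial_order B by fact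
  show ?thesis
    by (rule partial_orderI)
      (auto simp: binary_product_def intro: A.le_trans B.le_trans)
qed

lemma direct_product_partial_order:
  assumes "\<And>i. i \<in> I \<Longrightarrow> partial_order (F i)"
  shows "partial_order (direct_product I F)"
proof (rule partial_orderI)
  note po = assms
  note [simp] = direct_product_def
  have wpo: "weak_partial_order (F i)" if "i \<in> I" for i
    using po[OF that] by (simp add: partial_order_def)
  show "eq (direct_product I F) = (=)" by simp
  show "x \<sqsubseteq>\<^bsub>direct_product I F\<^esub> x" if "x \<in> carrier (direct_product I F)" for x
    using that by (auto intro!: weak_partial_order.le_refl[OF wpo])
  show "x = y" if "x \<in> carrier (direct_product I F)" "y \<in> carrier (direct_product I F)"
    "x \<sqsubseteq>\<^bsub>direct_product I F\<^esub> y" "y \<sqsubseteq>\<^bsub>direct_product I F\<^esub> x" for x y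
  proof (rule PiE_ext[of x I "\<lambda>i. carrier (F i)"])
    fix i assume i: "i \<in> I"
    show "x i = y i"
      using that i by (auto intro!: partial_order.le_antisym[OF po[OF i]])
  qed (use that in auto)
  show "x \<sqsubseteq>\<^bsub>direct_product I F\<^esub> z"
    if c: "x \<in> carrier (direct_product I F)" "y \<in> carrier (direct_product I F)"
      "z \<in> carrier (direct_product I F)"
      and l: "x \<sqsubseteq>\<^bsub>direct_product I F\<^esub> y" "y \<sqsubseteq>\<^bsub>direct_product I F\<^esub> z" for x y z
  proof -
    have "x i \<sqsubseteq>\<^bsub>F i\<^esub> z i" if i: "i \<in> I" for i
      by (rule weak_partial_order.le_trans[OF wpo[OF i], of "x i" "y i" "z i"])
        (use i c l in \<open>auto simp: PiE_iff\<close>)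
    then show ?thesis by simp
  qed
qed

lemma directly_indecomposable_any_type:
  fixes L :: "'a gorder" and A :: "'b gorder" and B :: "'c gorder"
  assumes L: "directly_indecomposable L"
    and A: "lattice A" "more_than_one_element A"
    and B: "lattice B" "more_than_one_element B"
  shows "\<not> lattice_isomorphic L (binary_product A B)"
proof
  assume iso: "lattice_isomorphic L (binary_product A B)"
  let ?P = "binary_product A B"
  obtain g where g: "order_iso g ?P L"
    using lattice_isomorphicD(3)[OF lattice_isomorphic_sym[OF iso]] by blast
  have inj: "inj_on g (carrier A \<times> carrier B)"
    using g by (simp add: order_iso_def bij_betw_def binary_product_def)
  obtain a b where ab: "a \<in> carrier A" "b \<in> carrier B"
    using A(2) B(2) by (auto simp: more_than_one_element_def)
  define p where "p = (\<lambda>x. g (x, b))"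
  define q where "q = (\<lambda>y. g (a, y))"
  have p: "inj_on p (carrier A)" and q: "inj_on q (carrier B)"
    using inj ab by (auto simp: inj_on_def p_def q_def)
  let ?A = "order_copy p A" and ?B = "order_copy q B"
  have lat: "lattice ?A" "lattice ?B" using order_copy(2) A(1) B(1) p q by auto
  have "more_than_one_element ?A" "more_than_one_element ?B"
    using A(2) B(2) p q by (auto simp: more_than_one_element_def order_copy_def inj_on_eq_iff)
  moreover have "order_iso (map_prod p q) ?P (binary_product ?A ?B)"
    using order_copy(1)[OF A(1) p] order_copy(1)[OF B(1) q]
    by (auto simp: order_iso_def binary_product_def bij_betw_map_prod)
  then have "lattice_isomorphic ?P (binary_product ?A ?B)"
    using lattice_isomorphicD(2)[OF iso] lat
    by (intro lattice_isomorphicI binary_product_partial_order lattice_partial_order)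
  then have "lattice_isomorphic L (binary_product ?A ?B)"
    using iso lattice_isomorphic_trans by blast
  ultimately show False using L lat unfolding directly_indecomposable_def by blast
qed

lemma directly_indecomposable_iso:
  assumes "directly_indecomposable L" "lattice_isomorphic L M"
  shows "directly_indecomposable M"
  unfolding directly_indecomposable_def
  using assms lattice_isomorphicD(2) lattice_isomorphic_trans directly_indecomposable_any_type
  by blast

lemma totally_decomposable_any_type:
  fixes L :: "'a gorder" and I :: "'i set" and F :: "'i \<Rightarrow> 'b gorder"
  assumes ne: "carrier L \<noteq> {}"
    and F: "\<And>i. i \<in> I \<Longrightarrow> directly_indecomposable (F i)"
    and iso: "lattice_isomorphic L (direct_product I F)"
  shows "totally_decomposable L"
proof -
  let ?P = "direct_product I F"
  have carP: "carrier ?P = (\<Pi>\<^sub>E i\<in>I. carrier (F i))" by (simp add: direct_product_def)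
  have lF: "lattice (F i)" if "i \<in> I" for i
    using F[OF that] by (simp add: directly_indecomposable_def)
  obtain g where g: "order_iso g ?P L"
    using lattice_isomorphicD(3)[OF lattice_isomorphic_sym[OF iso]] by blast
  have inj: "inj_on g (\<Pi>\<^sub>E i\<in>I. carrier (F i))" and im: "g ` (\<Pi>\<^sub>E i\<in>I. carrier (F i)) = carrier L"
    using g by (auto simp: order_iso_def bij_betw_def carP)
  obtain p where p: "p \<in> (\<Pi>\<^sub>E i\<in>I. carrier (F i))" using ne im by blast
  have upd: "p(i := x) \<in> (\<Pi>\<^sub>E i\<in>I. carrier (F i))" if "i \<in> I" "x \<in> carrier (F i)" for i x
    using p that by (auto simp: PiE_iff extensional_def)
  define e where "e = (\<lambda>i x. g (p(i := x)))"
  have e: "inj_on (e i) (carrier (F i))" if "i \<in> I" for i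
  proof (rule inj_onI)
    fix x y assume xy: "x \<in> carrier (F i)" "y \<in> carrier (F i)" "e i x = e i y"
    then have "p(i := x) = p(i := y)"
      using inj_onD[OF inj] upd that by (auto simp: e_def)
    then show "x = y" by (metis fun_upd_same)
  qed
  define J where "J = {i \<in> I. more_than_one_element (F i)}"
  have JI: "J \<subseteq> I" by (auto simp: J_def)
  have "\<exists>x. x \<in> carrier (F i) \<and> x \<noteq> p i" if "i \<in> J" for i
    using that by (auto simp: J_def more_than_one_element_def)
  then obtain q where q: "\<And>i. i \<in> J \<Longrightarrow> q i \<in> carrier (F i)" "\<And>i. i \<in> J \<Longrightarrow> q i \<noteq> p i"
    by metis
  define h where "h = (\<lambda>i. e i (q i))"
  have h: "inj_on h J"
  proof (rule inj_onI)
    fix i j assume ij: "i \<in> J" "j \<in> J" "h i = h j"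
    then have "p(i := q i) = p(j := q j)"
      using inj_onD[OF inj] upd JI q by (auto simp: h_def e_def subset_iff)
    then show "i = j" using q(2)[OF ij(1)] by (metis fun_upd_other fun_upd_same)
  qed
  define k where "k = inv_into J h"
  have k: "k (h i) = i" if "i \<in> J" for i using h that by (simp add: k_def)
  define G where "G = (\<lambda>m. order_copy (e (k m)) (F (k m)))"
  have G: "G (h i) = order_copy (e i) (F i)" if "i \<in> J" for i using k[OF that] by (simp add: G_def)
  have Gi: "directly_indecomposable (G m)" if m: "m \<in> h ` J" for m
  proof -
    obtain i where i: "i \<in> J" "m = h i" using m by blast
    then have iI: "i \<in> I" using JI by blast
    show ?thesis
      using directly_indecomposable_iso[OF F[OF iI] order_copy(3)[OF lF[OF iI] e[OF iI]]] G i
      by simp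
  qed
  let ?Q = "direct_product (h ` J) G"
  define t where "t = (\<lambda>x. \<lambda>m\<in>h ` J. e (k m) (x (k m)))"
  have t: "t x (h i) = e i (x i)" if "i \<in> J" for x i using that k by (simp add: t_def)
  have out: "x i = p i" if "x \<in> carrier ?P" "i \<in> I" "i \<notin> J" for x i
    using that p by (auto simp: carP J_def more_than_one_element_def PiE_iff)
  have carQ: "y \<in> carrier ?Q \<longleftrightarrow>
      (\<forall>i\<in>J. y (h i) \<in> e i ` carrier (F i)) \<and> y \<in> extensional (h ` J)" for y
    by (auto simp: direct_product_def PiE_iff G) (auto simp: G order_copy_def)
  have "bij_betw t (carrier ?P) (carrier ?Q)"
  proof (rule bij_betw_imageI)
    show "inj_on t (carrier ?P)"
    proof (rule inj_onI)
      fix x y assume xy: "x \<in> carrier ?P" "y \<in> carrier ?P" "t x = t y"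
      show "x = y"
      proof (rule PiE_ext[of x I "\<lambda>i. carrier (F i)"])
        fix i assume i: "i \<in> I"
        show "x i = y i"
        proof (cases "i \<in> J")
          case True
          then have "e i (x i) = e i (y i)" using t xy(3) by metis
          then show ?thesis using inj_onD[OF e[OF i]] xy i by (auto simp: carP PiE_iff)
        next
          case False
          then show ?thesis using out xy i by metis
        qed
      qed (use xy carP in auto)
    qed
    show "t ` carrier ?P = carrier ?Q"
    proof (intro equalityI subsetI)
      fix y assume "y \<in> t ` carrier ?P"
      then obtain x where x: "x \<in> carrier ?P" "y = t x" by blast
      have "y \<in> extensional (h ` J)" using x by (simp add: t_def)
      then show "y \<in> carrier ?Q" using x JI by (auto simp: carQ t carP PiE_iff subset_iff)
    next
      fix y assume y: "y \<in> carrier ?Q"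
      define x where "x = (\<lambda>i. if i \<in> J then inv_into (carrier (F i)) (e i) (y (h i)) else p i)"
      have x: "x i \<in> carrier (F i)" "e i (x i) = y (h i)" if "i \<in> J" for i
        using y that by (auto simp: carQ x_def inv_into_into f_inv_into_f)
      have xp: "x i = p i" if "i \<notin> J" for i using that by (simp add: x_def)
      have "x \<in> carrier ?P"
        unfolding carP
      proof (rule PiE_I)
        show "x i \<in> carrier (F i)" if "i \<in> I" for i
          using x(1) xp PiE_mem[OF p that] by (cases "i \<in> J") simp_all
        show "x i = undefined" if "i \<notin> I" for i
        proof -
          have "i \<notin> J" using that JI by blast
          then show ?thesis using trans[OF xp PiE_arb[OF p that]] by blast
        qed
      qed
      moreover have "t x = y"
      proof
        fix m
        show "t x m = y m"
        proof (cases "m \<in> h ` J")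
          case True
          then show ?thesis using t x(2) by auto
        next
          case False
          then show ?thesis using y by (auto simp: t_def carQ extensional_def)
        qed
      qed
      ultimately show "y \<in> t ` carrier ?P" by blast
    qed
  qed
  moreover have "x \<sqsubseteq>\<^bsub>?P\<^esub> y \<longleftrightarrow> t x \<sqsubseteq>\<^bsub>?Q\<^esub> t y"
    if xy: "x \<in> carrier ?P" "y \<in> carrier ?P" for x y
  proof -
    have c: "x i \<in> carrier (F i)" "y i \<in> carrier (F i)" if "i \<in> I" for i
      using xy that by (auto simp: carP PiE_iff)
    have refl: "p i \<sqsubseteq>\<^bsub>F i\<^esub> p i" if "i \<in> I" for i
    proof -
      interpret lattice "F i" by (rule lF[OF that])
      show ?thesis using p that by (auto simp: PiE_iff)
    qed
    have "x \<sqsubseteq>\<^bsub>?P\<^esub> y \<longleftrightarrow> (\<forall>i\<in>I. x i \<sqsubseteq>\<^bsub>F i\<^esub> y i)" by (simp add: direct_product_def)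
    also have "\<dots> \<longleftrightarrow> (\<forall>i\<in>J. x i \<sqsubseteq>\<^bsub>F i\<^esub> y i)"
    proof (intro iffI ballI)
      fix i assume "\<forall>i\<in>I. x i \<sqsubseteq>\<^bsub>F i\<^esub> y i" "i \<in> J"
      then show "x i \<sqsubseteq>\<^bsub>F i\<^esub> y i" using JI by blast
    next
      fix i assume "\<forall>i\<in>J. x i \<sqsubseteq>\<^bsub>F i\<^esub> y i" "i \<in> I"
      then show "x i \<sqsubseteq>\<^bsub>F i\<^esub> y i"
        using out[OF xy(1)] out[OF xy(2)] refl by (cases "i \<in> J") auto
    qed
    also have "\<dots> \<longleftrightarrow> (\<forall>i\<in>J. e i (x i) \<sqsubseteq>\<^bsub>G (h i)\<^esub> e i (y i))"
      using order_copy(1)[OF lF e] c JI by (auto simp: G order_iso_def subset_iff)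
    also have "\<dots> \<longleftrightarrow> t x \<sqsubseteq>\<^bsub>?Q\<^esub> t y" by (simp add: direct_product_def t)
    finally show ?thesis .
  qed
  ultimately have "order_iso t ?P ?Q" by (simp add: order_iso_def)
  moreover have "partial_order ?Q"
    by (rule direct_product_partial_order)
      (use Gi in \<open>auto simp: directly_indecomposable_def intro!: lattice_partial_order\<close>)
  ultimately have "lattice_isomorphic ?P ?Q"
    using lattice_isomorphicD(2)[OF iso] lattice_isomorphicI by blast
  then have "lattice_isomorphic L ?Q" using iso lattice_isomorphic_trans by blast
  then show ?thesis unfolding totally_decomposable_def using Gi by blast
qed

end

theory Submission
  imports Defs
begin

text \<open>Let \<open>U\<close> be a free ultrafilter on the natural numbers. The lattice consists of the triples
  \<open>(A, B, b)\<close> with \<open>A \<subseteq> B\<close>, where the truth value \<open>b\<close> satisfies \<open>A \<in> U \<longrightarrow> b\<close> and \<open>b \<longrightarrow> B \<in> U\<close>.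
  Since \<open>U\<close> is prime, finite joins and meets are computed componentwise, so the lattice is
  distributive, and \<open>(A, B, b) \<mapsto> (- B, - A, \<not> b)\<close> is a self-duality. The complemented elements are
  the triples \<open>(X, X, X \<in> U)\<close>, which form a complete sublattice isomorphic to the powerset. In a
  decomposition into indecomposable factors, each factor corresponds to at most a singleton \<open>X\<close>;
  but \<open>(\<emptyset>, \<nat>, False)\<close> and \<open>(\<emptyset>, \<nat>, True)\<close> have the same meet with every such triple, because
  \<open>U\<close> is free.\<close>

section \<open>Free ultrafilters\<close>

locale free_ultrafilter =
  fixes U :: "'a set set"
  assumes infinite_mem: "A \<in> U \<Longrightarrow> infinite A"
    and superset_mem: "A \<in> U \<Longrightarrow> A \<subseteq> B \<Longrightarrow> B \<in> U"
    and Int_mem: "A \<in> U \<Longrightarrow> B \<in> U \<Longrightarrow> A \<inter> B \<in> U"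
    and mem_or_Compl_mem: "A \<in> U \<or> - A \<in> U"
begin

lemma empty_not_mem: "{} \<notin> U"
  using infinite_mem by blast

lemma Compl_mem_iff: "- A \<in> U \<longleftrightarrow> A \<notin> U"
  using mem_or_Compl_mem[of A] Int_mem[of A "- A"] empty_not_mem by auto

lemma Int_mem_iff: "A \<inter> B \<in> U \<longleftrightarrow> A \<in> U \<and> B \<in> U"
  using Int_mem superset_mem by blast

lemma Un_mem_iff: "A \<union> B \<in> U \<longleftrightarrow> A \<in> U \<or> B \<in> U"
  using Int_mem_iff[of "- A" "- B"] Compl_mem_iff by (metis Compl_Un)

lemma UNIV_mem: "UNIV \<in> U"
  using Compl_mem_iff[of "{}"] empty_not_mem by simp

end

text \<open>Zorn's lemma is applied to families whose finite intersections are all infinite, not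
  merely nonempty, so that a maximal family is an ultrafilter and free at once.\<close>

lemma free_ultrafilter_exists:
  assumes "infinite (UNIV :: 'a set)"
  shows "\<exists>U :: 'a set set. free_ultrafilter U"
proof -
  define P where "P = {M :: 'a set set. \<forall>K. finite K \<and> K \<subseteq> M \<longrightarrow> infinite (\<Inter>K)}"
  have "\<exists>M\<in>P. \<forall>X\<in>P. M \<subseteq> X \<longrightarrow> X = M"
  proof (rule subset_Zorn_nonempty)
    \<comment> \<open>The empty family qualifies because \<open>\<Inter>{}\<close> is
      \<open>UNIV\<close>; here the infinite type enters.\<close>
    show "P \<noteq> {}"
      using assms by (auto simp: P_def intro!: exI[of _ "{}"])
    fix C assume C: "C \<noteq> {}" "subset.chain P C"
    have "infinite (\<Inter>K)" if K: "finite K" "K \<subseteq> \<Union>C" for K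
    proof -
      obtain M where "M \<in> C" "K \<subseteq> M"
        using finite_subset_Union_chain[OF K C] .
      then show ?thesis
        using C(2) K(1) by (auto simp: P_def subset_chain_def)
    qed
    then show "\<Union>C \<in> P" by (auto simp: P_def)
  qed
  then obtain M where M: "M \<in> P" and max: "\<And>X. X \<in> P \<Longrightarrow> M \<subseteq> X \<Longrightarrow> X = M" by blast
  have inf: "infinite (A \<inter> \<Inter>K)" if "A \<in> M" "finite K" "K \<subseteq> M" for A K
  proof -
    have "finite (insert A K) \<and> insert A K \<subseteq> M" using that by simp
    then have "infinite (\<Inter>(insert A K))" using M unfolding P_def by blast
    then show ?thesis by simp
  qed
  \<comment> \<open>Maximality as a membership test: a set that meets every finite intersection from
    \<open>M\<close> in an infinite set can be added to \<open>M\<close>, hence lies in it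
    already.\<close>
  have mem: "A \<in> M" if A: "\<And>K. finite K \<Longrightarrow> K \<subseteq> M \<Longrightarrow> infinite (A \<inter> \<Inter>K)" for A
  proof -
    have "infinite (\<Inter>K)" if "finite K" "K \<subseteq> insert A M" for K
    proof -
      have "infinite (A \<inter> \<Inter>(K - {A}))" by (rule A) (use that in auto)
      moreover have "A \<inter> \<Inter>(K - {A}) \<subseteq> \<Inter>K" by blast
      ultimately show ?thesis by (meson finite_subset)
    qed
    then have "insert A M \<in> P" by (simp add: P_def)
    from max[OF this] show "A \<in> M" by blast
  qed
  have "free_ultrafilter M"
  proof
    show "infinite A" if "A \<in> M" for A
      using inf[OF that, of "{}"] by simp
    show "B \<in> M" if "A \<in> M" "A \<subseteq> B" for A B
    proof (rule mem)
      fix K assume "finite K" "K \<subseteq> M"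
      then have "infinite (A \<inter> \<Inter>K)" by (rule inf[OF that(1)])
      then show "infinite (B \<inter> \<Inter>K)"
        by (rule contrapos_nn) (rule finite_subset[OF Int_mono[OF that(2) order_refl]])
    qed
    show "A \<inter> B \<in> M" if "A \<in> M" "B \<in> M" for A B
    proof (rule mem)
      fix K assume "finite K" "K \<subseteq> M"
      then have "infinite (A \<inter> \<Inter>(insert B K))" by (intro inf that) (use that in auto)
      then show "infinite (A \<inter> B \<inter> \<Inter>K)" by (simp add: Int_assoc)
    qed
    show "A \<in> M \<or> - A \<in> M" for A
    proof (rule ccontr)
      assume neg: "\<not> (A \<in> M \<or> - A \<in> M)"
      \<comment> \<open>If both \<open>A\<close> and \<open>- A\<close> fail the test, the two
        witnesses together give a finite intersection from \<open>M\<close> that is covered by two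
        finite sets.\<close>
      obtain K where K: "finite K" "K \<subseteq> M" "finite (A \<inter> \<Inter>K)"
        using mem[of A] neg by auto
      obtain L where L: "finite L" "L \<subseteq> M" "finite (- A \<inter> \<Inter>L)"
        using mem[of "- A"] neg by auto
      have "infinite (\<Inter>(K \<union> L))"
        using M K(1,2) L(1,2) unfolding P_def by (metis (lifting) Un_least finite_UnI mem_Collect_eq)
      moreover have "\<Inter>(K \<union> L) \<subseteq> (A \<inter> \<Inter>K) \<union> (- A \<inter> \<Inter>L)" by blast
      ultimately show False using K(3) L(3) by (meson finite_subset finite_UnI)
    qed
  qed
  then show ?thesis by blast
qed


section \<open>Lattices of sets\<close>

text \<open>Working with sets under inclusion lets distributivity be inherited from union and
  intersection, and restricting the carrier again gives a \<open>set_order\<close>.\<close>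

definition set_order :: "'a set set \<Rightarrow> 'a set gorder" where
  "set_order R = \<lparr>carrier = R, eq = (=), le = (\<subseteq>)\<rparr>"

lemma set_order_simps [simp]:
  "carrier (set_order R) = R"
  "eq (set_order R) = (=)"
  "S \<sqsubseteq>\<^bsub>set_order R\<^esub> T \<longleftrightarrow> S \<subseteq> T"
  "(set_order R)\<lparr>carrier := Q\<rparr> = set_order Q"
  by (simp_all add: set_order_def)

lemma set_order_partial_order: "partial_order (set_order R)"
  by (rule partial_orderI) auto

text \<open>The intersection \<open>A \<inter> R\<close> reflects that \<open>Upper\<close> only
  tests members of \<open>A\<close> lying in the carrier.\<close>

lemma set_order_is_lub_iff:
  "is_lub (set_order R) s A \<longleftrightarrow>
    s \<in> R \<and> (\<forall>a\<in>A \<inter> R. a \<subseteq> s) \<and> (\<forall>t\<in>R. (\<forall>a\<in>A \<inter> R. a \<subseteq> t) \<longrightarrow> s \<subseteq> t)"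
proof -
  have "Upper (set_order R) A = {t \<in> R. \<forall>a\<in>A \<inter> R. a \<subseteq> t}"
    unfolding Upper_def by (rule Set.set_eqI) (simp add: Ball_def conj_commute)
  then show ?thesis unfolding least_def by auto
qed

lemma set_order_is_glb_iff:
  "is_glb (set_order R) s A \<longleftrightarrow>
    s \<in> R \<and> (\<forall>a\<in>A \<inter> R. s \<subseteq> a) \<and> (\<forall>t\<in>R. (\<forall>a\<in>A \<inter> R. t \<subseteq> a) \<longrightarrow> t \<subseteq> s)"
proof -
  have "Lower (set_order R) A = {t \<in> R. \<forall>a\<in>A \<inter> R. t \<subseteq> a}"
    unfolding Lower_def by (rule Set.set_eqI) (simp add: Ball_def conj_commute)
  then show ?thesis unfolding greatest_def by auto
qed

lemma set_order_sup_eq: "is_lub (set_order R) s A \<Longrightarrow> \<Squnion>\<^bsub>set_order R\<^esub>A = s"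
  unfolding sup_def
  by (rule some_equality, assumption) (rule partial_order.least_unique[OF set_order_partial_order])

lemma set_order_inf_eq: "is_glb (set_order R) s A \<Longrightarrow> \<Sqinter>\<^bsub>set_order R\<^esub>A = s"
  unfolding inf_def
  by (rule some_equality, assumption) (rule partial_order.greatest_unique[OF set_order_partial_order])

section \<open>Rings of sets: distributivity, centre, splitting\<close>

definition ring_of_sets :: "'a set set \<Rightarrow> bool" where
  "ring_of_sets R \<longleftrightarrow> (\<forall>S\<in>R. \<forall>T\<in>R. S \<union> T \<in> R \<and> S \<inter> T \<in> R)"

lemma ring_of_sets_is_lub:
  assumes "ring_of_sets R" "S \<in> R" "T \<in> R"
  shows "is_lub (set_order R) (S \<union> T) {S, T}"
  using assms unfolding set_order_is_lub_iff ring_of_sets_def by simp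

lemma ring_of_sets_is_glb:
  assumes "ring_of_sets R" "S \<in> R" "T \<in> R"
  shows "is_glb (set_order R) (S \<inter> T) {S, T}"
  using assms unfolding set_order_is_glb_iff ring_of_sets_def by simp

lemma ring_of_sets_join:
  assumes "ring_of_sets R" "S \<in> R" "T \<in> R"
  shows "S \<squnion>\<^bsub>set_order R\<^esub> T = S \<union> T"
  unfolding join_def by (rule set_order_sup_eq[OF ring_of_sets_is_lub[OF assms]])

lemma ring_of_sets_meet:
  assumes "ring_of_sets R" "S \<in> R" "T \<in> R"
  shows "S \<sqinter>\<^bsub>set_order R\<^esub> T = S \<inter> T"
  unfolding meet_def by (rule set_order_inf_eq[OF ring_of_sets_is_glb[OF assms]])

lemma ring_of_sets_lattice: "ring_of_sets R \<Longrightarrow> lattice (set_order R)"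
  by (rule latticeI[OF set_order_partial_order])
    (auto intro: ring_of_sets_is_lub ring_of_sets_is_glb)

lemma ring_of_sets_distributive:
  assumes R: "ring_of_sets R"
  shows "distributive_lattice (set_order R)"
proof -
  interpret lattice "set_order R" by (rule ring_of_sets_lattice[OF R])
  show ?thesis
  proof
    fix x y z assume "x \<in> carrier (set_order R)" "y \<in> carrier (set_order R)" "z \<in> carrier (set_order R)"
    then have c: "x \<in> R" "y \<in> R" "z \<in> R" by simp_all
    moreover have "y \<union> z \<in> R" "x \<inter> y \<in> R" "x \<inter> z \<in> R"
      using R c by (auto simp: ring_of_sets_def)
    ultimately show "x \<sqinter>\<^bsub>set_order R\<^esub> (y \<squnion>\<^bsub>set_order R\<^esub> z) =
        (x \<sqinter>\<^bsub>set_order R\<^esub> y) \<squnion>\<^bsub>set_order R\<^esub> (x \<sqinter>\<^bsub>set_order R\<^esub> z)"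
      by (simp add: ring_of_sets_join[OF R] ring_of_sets_meet[OF R] Int_Un_distrib)
  qed
qed

lemma ring_of_sets_sublattice:
  assumes R: "ring_of_sets R"
  shows "sublattice (set_order R) Q \<longleftrightarrow> Q \<subseteq> R \<and> ring_of_sets Q"
proof (cases "Q \<subseteq> R")
  case True
  then have R': "S \<in> R" if "S \<in> Q" for S using that by blast
  have "(\<forall>S\<in>Q. \<forall>T\<in>Q. S \<squnion>\<^bsub>set_order R\<^esub> T \<in> Q \<and> S \<sqinter>\<^bsub>set_order R\<^esub> T \<in> Q) \<longleftrightarrow> ring_of_sets Q"
    unfolding ring_of_sets_def
    by (intro ball_cong refl) (simp add: ring_of_sets_join[OF R] ring_of_sets_meet[OF R] R')
  then show ?thesis using True unfolding sublattice_def by simp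
qed (simp add: sublattice_def)

text \<open>An intersection of rings of sets is a ring of sets, so every generated sublattice is
  distributive. In the centre only complementedness remains to be examined.\<close>

lemma ring_of_sets_neutral:
  assumes R: "ring_of_sets R" and S: "S \<in> R"
  shows "neutral (set_order R) S"
proof -
  have "ring_of_sets (generated_sublattice (set_order R) X)" for X
    unfolding generated_sublattice_def ring_of_sets_sublattice[OF R]
    unfolding ring_of_sets_def by blast
  then show ?thesis
    unfolding neutral_def using S by (simp add: ring_of_sets_distributive)
qed

lemma set_order_bottom: "{} \<in> R \<Longrightarrow> \<bottom>\<^bsub>set_order R\<^esub> = {}"
  unfolding bottom_def by (rule some_equality) (auto simp: least_def)

lemma set_order_top: "UNIV \<in> R \<Longrightarrow> \<top>\<^bsub>set_order R\<^esub> = UNIV"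
  unfolding top_def by (rule some_equality) (auto simp: greatest_def)

text \<open>As bottom and top are \<open>{}\<close> and \<open>UNIV\<close>, a lattice complement
  can only be the set complement.\<close>

lemma ring_of_sets_Cen:
  assumes R: "ring_of_sets R" and "{} \<in> R" "UNIV \<in> R"
  shows "Cen (set_order R) = {S \<in> R. - S \<in> R}"
proof -
  have "S \<union> T = UNIV \<and> S \<inter> T = {} \<longleftrightarrow> T = - S" for S T :: "'a set" by blast
  then have "complemented (set_order R) S \<longleftrightarrow> S \<in> R \<and> - S \<in> R" for S
    by (auto simp: complemented_def set_order_top[OF assms(3)] set_order_bottom[OF assms(2)]
         ring_of_sets_join[OF R] ring_of_sets_meet[OF R]
        cong: conj_cong)
  then show ?thesis
    using ring_of_sets_neutral[OF R] by (auto simp: Cen_def)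
qed

text \<open>The ideal below a disjoint union is the product of the ideals below its two parts: cut a
  set into its traces on \<open>a\<close> and \<open>b\<close>, and recover it as their union. Later
  this bounds the size of a central element that belongs to an indecomposable factor.\<close>

lemma ring_of_sets_not_directly_indecomposable:
  assumes R: "ring_of_sets R" "{} \<in> R"
    and ab: "a \<in> R" "b \<in> R" "a \<inter> b = {}" "a \<noteq> {}" "b \<noteq> {}"
  shows "\<not> directly_indecomposable (set_order {S \<in> R. S \<subseteq> a \<union> b})"
proof
  let ?L = "\<lambda>c. {S \<in> R. S \<subseteq> c}"
  let ?f = "\<lambda>S. (S \<inter> a, S \<inter> b)"
  let ?P = "binary_product (set_order (?L a)) (set_order (?L b))"
  assume ind: "directly_indecomposable (set_order (?L (a \<union> b)))"
  have ring: "ring_of_sets (?L c)" for c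
    using R(1) by (auto simp: ring_of_sets_def)
  have more: "more_than_one_element (set_order (?L c))" if "c \<in> R" "c \<noteq> {}" for c
    using that R(2) unfolding more_than_one_element_def by (auto intro!: bexI[of _ "{}"])
  have "bij_betw ?f (?L (a \<union> b)) (?L a \<times> ?L b)"
  proof (rule bij_betw_byWitness[where f' = "\<lambda>(p, q). p \<union> q"])
    show "\<forall>S\<in>?L (a \<union> b). (\<lambda>(p, q). p \<union> q) (?f S) = S" by auto
    show "\<forall>z\<in>?L a \<times> ?L b. ?f ((\<lambda>(p, q). p \<union> q) z) = z" using ab(3) by auto
    show "?f ` ?L (a \<union> b) \<subseteq> ?L a \<times> ?L b" using R(1) ab by (auto simp: ring_of_sets_def)
    show "(\<lambda>(p, q). p \<union> q) ` (?L a \<times> ?L b) \<subseteq> ?L (a \<union> b)"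
      using R(1) by (auto simp: ring_of_sets_def)
  qed
  moreover have "S \<subseteq> T \<longleftrightarrow> S \<inter> a \<subseteq> T \<inter> a \<and> S \<inter> b \<subseteq> T \<inter> b" if "S \<subseteq> a \<union> b" for S T
    using that by blast
  ultimately have "order_iso ?f (set_order (?L (a \<union> b))) ?P"
    by (simp add: order_iso_def binary_product_def)
  then have "lattice_isomorphic (set_order (?L (a \<union> b))) ?P"
    by (rule lattice_isomorphicI)
      (intro ring_of_sets_lattice ring binary_product_partial_order set_order_partial_order)+
  then show False
    using ind more ab ring_of_sets_lattice[OF ring] unfolding directly_indecomposable_def by blast
qed

section \<open>The lattice of an ultrafilter\<close>

text \<open>A triple is coded as one set of numbers: 0 stands for the truth value, odd numbers for
  the first component, positive even numbers for the second. The componentwise order becomes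
  inclusion, so the results on rings of sets apply.\<close>

definition low :: "nat set \<Rightarrow> nat set" where
  "low S = {n. 2 * n + 1 \<in> S}"

definition high :: "nat set \<Rightarrow> nat set" where
  "high S = {n. 2 * n + 2 \<in> S}"

definition triple :: "nat set \<Rightarrow> nat set \<Rightarrow> bool \<Rightarrow> nat set" where
  "triple A B b = {k. k = 0 \<and> b \<or> (\<exists>n\<in>A. k = 2 * n + 1) \<or> (\<exists>n\<in>B. k = 2 * n + 2)}"

lemma low_triple [simp]: "low (triple A B b) = A"
  unfolding low_def triple_def by (auto; presburger)

lemma high_triple [simp]: "high (triple A B b) = B"
  unfolding high_def triple_def by (auto; presburger)

lemma zero_mem_triple [simp]: "0 \<in> triple A B b \<longleftrightarrow> b"
  unfolding triple_def by auto

lemma triple_subset_iff: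
  "S \<subseteq> T \<longleftrightarrow> low S \<subseteq> low T \<and> high S \<subseteq> high T \<and> (0 \<in> S \<longrightarrow> 0 \<in> T)"
proof
  assume r: "low S \<subseteq> low T \<and> high S \<subseteq> high T \<and> (0 \<in> S \<longrightarrow> 0 \<in> T)"
  show "S \<subseteq> T"
  proof
    fix k assume k: "k \<in> S"
    have "k = 0 \<or> (\<exists>n. k = 2 * n + 1) \<or> (\<exists>n. k = 2 * n + 2)" by presburger
    then consider "k = 0" | n where "k = 2 * n + 1" | n where "k = 2 * n + 2" by blast
    then show "k \<in> T" using k r by cases (auto simp: low_def high_def)
  qed
qed (auto simp: low_def high_def)

lemma triple_eq_iff:
  "S = T \<longleftrightarrow> low S = low T \<and> high S = high T \<and> (0 \<in> S \<longleftrightarrow> 0 \<in> T)"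
  using triple_subset_iff[of S T] triple_subset_iff[of T S] by auto

lemma low_high_simps [simp]:
  "low {} = {}" "high {} = {}" "low UNIV = UNIV" "high UNIV = UNIV"
  "low (S \<union> T) = low S \<union> low T" "high (S \<union> T) = high S \<union> high T"
  "low (S \<inter> T) = low S \<inter> low T" "high (S \<inter> T) = high S \<inter> high T"
  "low (- S) = - low S" "high (- S) = - high S"
  by (auto simp: low_def high_def)

section \<open>The lattice \<open>D\<close>: central elements, completeness, self-duality\<close>

locale nat_free_ultrafilter = free_ultrafilter U for U :: "nat set set"
begin

definition D :: "nat set set" where
  "D = {S. low S \<subseteq> high S \<and> (low S \<in> U \<longrightarrow> 0 \<in> S) \<and> (0 \<in> S \<longrightarrow> high S \<in> U)}"

definition e :: "nat set \<Rightarrow> nat set" where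
  "e X = triple X X (X \<in> U)"

lemma low_e [simp]: "low (e X) = X"
  and high_e [simp]: "high (e X) = X"
  and zero_mem_e [simp]: "0 \<in> e X \<longleftrightarrow> X \<in> U"
  by (simp_all add: e_def)

lemma e_in_D: "e X \<in> D"
  by (simp add: D_def)

lemma empty_in_D: "{} \<in> D"
  by (simp add: D_def empty_not_mem)

lemma UNIV_in_D: "UNIV \<in> D"
  by (simp add: D_def UNIV_mem)

lemma ring_of_sets_D: "ring_of_sets D"
  by (auto simp: ring_of_sets_def D_def Un_mem_iff Int_mem_iff)

text \<open>With the next lemma this says that \<open>e\<close> has the right adjoint
  \<open>low\<close> and the left adjoint \<open>high\<close>. The truth values take care of
  themselves: if \<open>X\<close> is in \<open>U\<close>, so is \<open>low S\<close>, which forces 0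
  into \<open>S\<close>.\<close>

lemma e_subset_iff: "S \<in> D \<Longrightarrow> e X \<subseteq> S \<longleftrightarrow> X \<subseteq> low S"
  unfolding triple_subset_iff[of "e X" S] by (auto simp: D_def dest: superset_mem)

lemma subset_e_iff: "S \<in> D \<Longrightarrow> S \<subseteq> e X \<longleftrightarrow> high S \<subseteq> X"
  unfolding triple_subset_iff[of S "e X"] by (auto simp: D_def dest: superset_mem)

lemma Cen_D: "Cen (set_order D) = range e"
proof -
  have "S \<in> D \<and> - S \<in> D \<longleftrightarrow> S \<in> range e" for S
  proof
    assume "S \<in> D \<and> - S \<in> D"
    \<comment> \<open>Membership of the complement reverses \<open>low S \<subseteq> high S\<close>,
      so the components agree; the two conditions on 0 then fix the truth value.\<close>
    then have "S = e (low S)" unfolding triple_eq_iff[of S "e (low S)"] by (auto simp: D_def)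
    then show "S \<in> range e" by (rule range_eqI)
  next
    assume "S \<in> range e"
    then show "S \<in> D \<and> - S \<in> D" by (auto simp: D_def Compl_mem_iff)
  qed
  then show ?thesis
    unfolding ring_of_sets_Cen[OF ring_of_sets_D empty_in_D UNIV_in_D] by blast
qed

text \<open>A join need not be the union: the first components may have a union in \<open>U\<close>
  although no member of the family contains 0. Then 0 must be added, since every upper bound in
  \<open>D\<close> contains it.\<close>

lemma is_lub_D:
  assumes "\<A> \<subseteq> D"
  shows "is_lub (set_order D)
    (triple (\<Union>(low ` \<A>)) (\<Union>(high ` \<A>)) ((\<exists>S\<in>\<A>. 0 \<in> S) \<or> \<Union>(low ` \<A>) \<in> U)) \<A>"
    (is "is_lub _ ?s _")
proof -
  have A: "low S \<subseteq> high S" "0 \<in> S \<Longrightarrow> high S \<in> U" if "S \<in> \<A>" for S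
    using assms that by (auto simp: D_def)
  have "\<Union>(low ` \<A>) \<subseteq> \<Union>(high ` \<A>)" using A(1) by blast
  moreover have "\<Union>(high ` \<A>) \<in> U" if "S \<in> \<A>" "0 \<in> S" for S
    by (rule superset_mem[OF A(2)[OF that]]) (use that in blast)
  ultimately have "?s \<in> D"
    by (auto simp: D_def intro: superset_mem)
  moreover have "S \<subseteq> ?s" if "S \<in> \<A>" for S
    using that by (auto simp: triple_subset_iff[of S])
  moreover have "?s \<subseteq> T" if T: "T \<in> D" "\<forall>S\<in>\<A>. S \<subseteq> T" for T
  proof -
    have "low S \<subseteq> low T" "high S \<subseteq> high T" "0 \<in> S \<Longrightarrow> 0 \<in> T" if "S \<in> \<A>" for S
      using T(2) that triple_subset_iff[of S T] by blast+
    moreover from this have "\<Union>(low ` \<A>) \<in> U \<Longrightarrow> 0 \<in> T"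
      using T(1) superset_mem[of "\<Union>(low ` \<A>)" "low T"] unfolding D_def by blast
    ultimately show ?thesis by (auto simp: triple_subset_iff[of ?s T])
  qed
  ultimately show ?thesis
    using assms unfolding set_order_is_lub_iff by (simp add: Int_absorb2)
qed

definition dual :: "nat set \<Rightarrow> nat set" where
  "dual S = triple (- high S) (- low S) (0 \<notin> S)"

lemma dual_simps [simp]:
  "low (dual S) = - high S" "high (dual S) = - low S" "0 \<in> dual S \<longleftrightarrow> 0 \<notin> S"
  by (simp_all add: dual_def)

text \<open>Swapping the complemented components restores their inclusion, and the two conditions on
  the truth value become each other's contrapositives.\<close>

lemma dual_in_D: "S \<in> D \<Longrightarrow> dual S \<in> D"
  by (auto simp: D_def Compl_mem_iff)

lemma dual_dual: "dual (dual S) = S"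
  by (simp add: triple_eq_iff[of "dual (dual S)" S])

lemma dual_subset_iff: "dual S \<subseteq> dual T \<longleftrightarrow> T \<subseteq> S"
  by (auto simp: triple_subset_iff[of "dual S" "dual T"] triple_subset_iff[of T S])

text \<open>The order-reversing involution \<open>dual\<close> turns the join of the dual family
  into the required meet.\<close>

lemma is_glb_D:
  assumes "\<A> \<subseteq> D"
  shows "\<exists>s. is_glb (set_order D) s \<A>"
proof -
  have "dual ` \<A> \<subseteq> D" using assms dual_in_D by blast
  then obtain s where s: "is_lub (set_order D) s (dual ` \<A>)" using is_lub_D by blast
  have sub: "S \<subseteq> dual T \<longleftrightarrow> T \<subseteq> dual S" for S T
    using dual_subset_iff[of T "dual S"] dual_dual by (metis dual_subset_iff)
  have "is_glb (set_order D) (dual s) \<A>"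
    unfolding set_order_is_glb_iff
  proof (intro conjI ballI impI)
    show "dual s \<in> D" using s dual_in_D unfolding set_order_is_lub_iff by blast
    show "dual s \<subseteq> S" if "S \<in> \<A> \<inter> D" for S
    proof -
      have "dual S \<subseteq> s" using s that dual_in_D unfolding set_order_is_lub_iff by blast
      then show ?thesis using sub dual_dual dual_subset_iff by metis
    qed
    show "T \<subseteq> dual s" if T: "T \<in> D" "\<forall>S\<in>\<A> \<inter> D. T \<subseteq> S" for T
    proof -
      have "\<forall>S\<in>\<A>. dual S \<subseteq> dual T"
        unfolding dual_subset_iff using T(2) assms by blast
      then have "\<forall>S\<in>dual ` \<A> \<inter> D. S \<subseteq> dual T" by blast
      then have "s \<subseteq> dual T"
        using s dual_in_D[OF T(1)] unfolding set_order_is_lub_iff by blast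
      then show ?thesis by (simp add: sub)
    qed
  qed
  then show ?thesis by blast
qed

lemma complete_lattice_D: "complete_lattice (set_order D)"
proof (rule partial_order.complete_latticeI[OF set_order_partial_order])
  fix \<A> assume "\<A> \<subseteq> carrier (set_order D)"
  then have A: "\<A> \<subseteq> D" by simp
  show "\<exists>s. is_lub (set_order D) s \<A>" using is_lub_D[OF A] by blast
  show "\<exists>s. is_glb (set_order D) s \<A>" by (rule is_glb_D[OF A])
qed

lemma self_dual_D: "lattice_isomorphic (set_order D) (inv_gorder (set_order D))"
proof (rule lattice_isomorphicI)
  have "bij_betw dual D D"
    by (rule bij_betw_byWitness[where f' = dual]) (auto simp: dual_dual dual_in_D)
  then show "order_iso dual (set_order D) (inv_gorder (set_order D))"
    by (simp add: order_iso_def dual_subset_iff)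
  show "lattice (set_order D)" by (rule ring_of_sets_lattice[OF ring_of_sets_D])
  show "partial_order (inv_gorder (set_order D))" by (rule partial_orderI) auto
qed

section \<open>The centre as a complete atomistic sublattice\<close>

lemma complete_sublattice_Cen_D: "complete_sublattice (set_order D) (Cen (set_order D))"
proof -
  \<comment> \<open>Having adjoints on both sides, \<open>e\<close> carries unions to joins and
    intersections to meets, for the empty family as well.\<close>
  have "\<Squnion>\<^bsub>set_order D\<^esub>(e ` \<X>) = e (\<Union>\<X>)" for \<X>
    by (rule set_order_sup_eq, unfold set_order_is_lub_iff)
      (simp add: e_in_D Int_absorb2 image_subset_iff e_subset_iff Union_upper Sup_le_iff)
  moreover have "\<Sqinter>\<^bsub>set_order D\<^esub>(e ` \<X>) = e (\<Inter>\<X>)" for \<X>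
    by (rule set_order_inf_eq, unfold set_order_is_glb_iff)
      (simp add: e_in_D Int_absorb2 image_subset_iff subset_e_iff Inter_lower le_Inf_iff)
  ultimately have "\<Squnion>\<^bsub>set_order D\<^esub>\<A> \<in> range e \<and> \<Sqinter>\<^bsub>set_order D\<^esub>\<A> \<in> range e"
    if "\<A> \<subseteq> range e" for \<A>
    using that unfolding subset_image_iff by auto
  then show ?thesis
    unfolding complete_sublattice_def Cen_D using e_in_D by auto
qed

lemma e_Un: "e X \<union> e Y = e (X \<union> Y)"
  and e_Int: "e X \<inter> e Y = e (X \<inter> Y)"
  by (simp_all add: triple_eq_iff[of "e X \<union> e Y"] triple_eq_iff[of "e X \<inter> e Y"]
      Un_mem_iff Int_mem_iff)

lemma e_empty: "e {} = {}"
  by (simp add: triple_eq_iff[of "e {}"] empty_not_mem)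

lemma e_eq_empty_iff: "e X = {} \<longleftrightarrow> X = {}"
  using low_e[of X] e_empty by (metis low_high_simps(1))

lemma e_le_e_iff: "e X \<subseteq> e Y \<longleftrightarrow> X \<subseteq> Y"
  by (simp add: e_subset_iff[OF e_in_D])

lemma atomistic_Cen_D: "atomistic (set_order (Cen (set_order D)))"
proof -
  let ?C = "set_order (range e)"
  have "ring_of_sets (range e)"
    by (auto simp: ring_of_sets_def e_Un e_Int)
  then have lat: "lattice ?C" by (rule ring_of_sets_lattice)
  have empty: "{} \<in> range e" using e_empty by (metis rangeI)
  have bot: "\<bottom>\<^bsub>?C\<^esub> = {}" by (rule set_order_bottom[OF empty])
  have least: "least ?C {} (carrier ?C)" using empty by (simp add: least_def)
  have at: "atom ?C (e {n})" for n
  proof -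
    have "e {n} \<noteq> {}" by (simp add: e_eq_empty_iff)
    moreover have "e X = {} \<or> e X = e {n}" if "e X \<subseteq> e {n}" for X
    proof -
      have "X = {} \<or> X = {n}" using that by (simp only: e_le_e_iff subset_singleton_iff)
      then show ?thesis by (auto simp: e_empty)
    qed
    ultimately show ?thesis
      unfolding atom_def bot by simp
  qed
  \<comment> \<open>No \<open>e {n}\<close> contains 0, since singletons are not in
    \<open>U\<close>. For \<open>X\<close> in \<open>U\<close> the join \<open>e X\<close> therefore
    exceeds the union of these atoms, yet no smaller central element lies above them all.\<close>
  have "is_lub ?C (e X) ((\<lambda>n. e {n}) ` X)" for X
    unfolding set_order_is_lub_iff
    by (simp add: e_le_e_iff Int_absorb2 image_subset_iff) (simp add: subset_iff)
  moreover have "(\<lambda>n. e {n}) ` X \<subseteq> {a. atom ?C a}" for X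
    using at by (simp add: image_subset_iff)
  ultimately have "\<exists>\<A>. \<A> \<subseteq> {a. atom ?C a} \<and> is_lub ?C (e X) \<A>" for X
    by (intro exI conjI)
  then have "\<forall>S\<in>carrier ?C. \<exists>\<A>. \<A> \<subseteq> {a. atom ?C a} \<and> is_lub ?C S \<A>"
    unfolding set_order_simps ball_simps by (rule allI)
  with lat least show ?thesis
    unfolding atomistic_def Cen_D by (intro conjI exI)
qed

section \<open>Failure of total decomposability\<close>

lemma not_totally_decomposable_D: "\<not> totally_decomposable (set_order D)"
proof
  assume "totally_decomposable (set_order D)"
  then obtain I :: "nat set set" and F :: "nat set \<Rightarrow> nat set gorder"
    where F: "\<And>i. i \<in> I \<Longrightarrow> directly_indecomposable (F i)"
      and iso: "lattice_isomorphic (set_order D) (direct_product I F)"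
    unfolding totally_decomposable_def by blast
  define P where "P = (\<Pi>\<^sub>E i\<in>I. carrier (F i))"
  obtain f where "order_iso f (set_order D) (direct_product I F)"
    using lattice_isomorphicD(3)[OF iso] by blast
  then have bij: "bij_betw f D P"
    and le: "\<And>S T. S \<in> D \<Longrightarrow> T \<in> D \<Longrightarrow> S \<subseteq> T \<longleftrightarrow> (\<forall>i\<in>I. f S i \<sqsubseteq>\<^bsub>F i\<^esub> f T i)"
    by (auto simp: order_iso_def direct_product_def P_def)
  have mono: "f S i \<sqsubseteq>\<^bsub>F i\<^esub> f T i" if "S \<subseteq> T" "S \<in> D" "T \<in> D" "i \<in> I" for S T i
    using le[OF that(2,3)] that(1,4) by blast
  have po: "partial_order (F i)" if "i \<in> I" for i
    using F[OF that] by (simp add: directly_indecomposable_def lattice_partial_order)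
  have fP: "f S \<in> P" if "S \<in> D" for S
    using bij that by (rule bij_betw_apply)
  have fc: "f S i \<in> carrier (F i)" if "S \<in> D" "i \<in> I" for S i
    using fP[OF that(1)] that(2) unfolding P_def by (rule PiE_mem)
  have refl: "f S i \<sqsubseteq>\<^bsub>F i\<^esub> f S i" if "S \<in> D" "i \<in> I" for S i
    using le[OF that(1) that(1)] that(2) by blast
  have upd: "\<exists>T\<in>D. f T = (f S)(i := z)" if "S \<in> D" "i \<in> I" "z \<in> carrier (F i)" for S i z
  proof -
    have "(f S)(i := z) \<in> P"
      using fP[OF that(1)] that(2,3) by (auto simp: P_def PiE_iff extensional_def)
    then show ?thesis using bij unfolding bij_betw_def by (metis imageE)
  qed
  \<comment> \<open>Boundedness of the factors is not given; changing one coordinate of the image of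
    \<open>{}\<close> shows that the coordinates of the bounds of \<open>D\<close> bound each
    factor.\<close>
  have bot: "f {} i \<sqsubseteq>\<^bsub>F i\<^esub> z" and top: "z \<sqsubseteq>\<^bsub>F i\<^esub> f UNIV i"
    if iz: "i \<in> I" "z \<in> carrier (F i)" for i z
  proof -
    obtain T where T: "T \<in> D" "f T = (f {})(i := z)" using upd[OF empty_in_D iz] by blast
    have "f T i = z" using T(2) by simp
    then show "f {} i \<sqsubseteq>\<^bsub>F i\<^esub> z" "z \<sqsubseteq>\<^bsub>F i\<^esub> f UNIV i"
      using le[OF empty_in_D T(1)] le[OF T(1) UNIV_in_D] iz(1) by blast+
  qed
  \<comment> \<open>The two elements differ only in 0, and both truth values are admissible because
    \<open>{}\<close> is outside \<open>U\<close> and \<open>UNIV\<close> inside. Some coordinate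
    \<open>i\<close> must tell them apart.\<close>
  define x where "x = triple {} UNIV False"
  define y where "y = triple {} UNIV True"
  have x: "x \<in> D" and y: "y \<in> D"
    by (auto simp: D_def x_def y_def UNIV_mem empty_not_mem)
  have "\<not> y \<subseteq> x" using triple_subset_iff[of y x] by (simp add: x_def y_def)
  then obtain i where i: "i \<in> I" and nle: "\<not> f y i \<sqsubseteq>\<^bsub>F i\<^esub> f x i"
    using le[OF y x] by blast
  \<comment> \<open>The central element of factor \<open>i\<close>: top there and bottom in all
    other coordinates. Its opposite \<open>d\<close> will turn out to be its complement.\<close>
  obtain c where c: "c \<in> D" and fc_eq: "f c = (f {})(i := f UNIV i)"
    using upd[OF empty_in_D i fc[OF UNIV_in_D i]] by blast
  obtain d where d: "d \<in> D" and fd_eq: "f d = (f UNIV)(i := f {} i)"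
    using upd[OF UNIV_in_D i fc[OF empty_in_D i]] by blast
  have f_at: "f c i = f UNIV i" "f d i = f {} i"
    and f_off: "\<And>j. j \<noteq> i \<Longrightarrow> f c j = f {} j" "\<And>j. j \<noteq> i \<Longrightarrow> f d j = f UNIV j"
    by (simp_all add: fc_eq fd_eq)
  have cd: "c \<union> d \<in> D" "c \<inter> d \<in> D"
    using ring_of_sets_D c d by (auto simp: ring_of_sets_def)
  have "f UNIV j \<sqsubseteq>\<^bsub>F j\<^esub> f (c \<union> d) j" if "j \<in> I" for j
    using mono[OF Un_upper1 c cd(1) that] mono[OF Un_upper2 d cd(1) that] f_at f_off
    by (cases "j = i") simp_all
  then have "UNIV \<subseteq> c \<union> d" using le[OF UNIV_in_D cd(1)] by blast
  moreover have "f (c \<inter> d) j \<sqsubseteq>\<^bsub>F j\<^esub> f {} j" if "j \<in> I" for j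
    using mono[OF Int_lower1 cd(2) c that] mono[OF Int_lower2 cd(2) d that] f_at f_off
    by (cases "j = i") simp_all
  then have "c \<inter> d \<subseteq> {}" using le[OF cd(2) empty_in_D] by blast
  ultimately have "d = - c" by blast
  then have "c \<in> Cen (set_order D)"
    using c d by (simp add: ring_of_sets_Cen[OF ring_of_sets_D empty_in_D UNIV_in_D])
  then obtain X where X: "c = e X" unfolding Cen_D by blast
  \<comment> \<open>Lying below \<open>c\<close> means being least off \<open>i\<close>, so
    projection to coordinate \<open>i\<close> identifies the ideal below \<open>c\<close> with
    \<open>F i\<close>.\<close>
  have below: "S \<subseteq> c \<longleftrightarrow> (\<forall>j\<in>I. j \<noteq> i \<longrightarrow> f S j = f {} j)" if S: "S \<in> D" for S
  proof
    assume "S \<subseteq> c"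
    have "f S j = f {} j" if j: "j \<in> I" "j \<noteq> i" for j
    proof (rule partial_order.le_antisym[OF po[OF j(1)] _ bot fc fc])
      show "f S j \<sqsubseteq>\<^bsub>F j\<^esub> f {} j"
        using mono[OF \<open>S \<subseteq> c\<close> S c j(1)] f_off(1)[OF j(2)] by simp
    qed (use j S fc empty_in_D in simp_all)
    then show "\<forall>j\<in>I. j \<noteq> i \<longrightarrow> f S j = f {} j" by blast
  next
    assume off: "\<forall>j\<in>I. j \<noteq> i \<longrightarrow> f S j = f {} j"
    have "f S j \<sqsubseteq>\<^bsub>F j\<^esub> f c j" if "j \<in> I" for j
      using off that f_at(1) f_off(1) refl[OF empty_in_D that] top[OF that fc[OF S that]]
      by (cases "j = i") simp_all
    then show "S \<subseteq> c" unfolding le[OF S c] by blast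
  qed
  let ?C = "set_order {S \<in> D. S \<subseteq> c}"
  have "order_iso (\<lambda>S. f S i) ?C (F i)"
  proof -
    have le_i: "S \<subseteq> T \<longleftrightarrow> f S i \<sqsubseteq>\<^bsub>F i\<^esub> f T i"
      if ST: "S \<in> D" "S \<subseteq> c" "T \<in> D" "T \<subseteq> c" for S T
    proof -
      have "f S j \<sqsubseteq>\<^bsub>F j\<^esub> f T j" if "j \<in> I" "j \<noteq> i" for j
        using below[OF ST(1)] below[OF ST(3)] ST(2,4) refl[OF empty_in_D that(1)] that by simp
      then show ?thesis unfolding le[OF ST(1,3)] using i by blast
    qed
    have "inj_on (\<lambda>S. f S i) {S \<in> D. S \<subseteq> c}"
    proof (rule inj_onI)
      fix S T assume ST: "S \<in> {S \<in> D. S \<subseteq> c}" "T \<in> {S \<in> D. S \<subseteq> c}" and eq: "f S i = f T i"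
      then have "f S i \<sqsubseteq>\<^bsub>F i\<^esub> f T i" "f T i \<sqsubseteq>\<^bsub>F i\<^esub> f S i" using refl i by auto
      then show "S = T" using le_i ST by blast
    qed
    moreover have "z \<in> (\<lambda>S. f S i) ` {S \<in> D. S \<subseteq> c}" if z: "z \<in> carrier (F i)" for z
    proof -
      obtain T where T: "T \<in> D" "f T = (f {})(i := z)" using upd[OF empty_in_D i z] by blast
      then have "T \<subseteq> c" using below by simp
      then show ?thesis using T by (auto intro!: rev_image_eqI[of T])
    qed
    ultimately show ?thesis
      using le_i fc i by (auto simp: order_iso_def bij_betw_def)
  qed
  moreover have "ring_of_sets {S \<in> D. S \<subseteq> c}"
    using ring_of_sets_D by (auto simp: ring_of_sets_def)
  ultimately have "lattice_isomorphic ?C (F i)"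
    by (intro lattice_isomorphicI ring_of_sets_lattice po[OF i])
  then have ind: "directly_indecomposable ?C"
    using F[OF i] directly_indecomposable_iso lattice_isomorphic_sym by blast
  \<comment> \<open>Splitting a point off \<open>X\<close> would split the ideal below
    \<open>c\<close>, which is indecomposable like \<open>F i\<close>; so \<open>X\<close> has at
    most one element.\<close>
  have "X - {n} = {}" if n: "n \<in> X" for n
  proof (rule ccontr)
    assume ne: "X - {n} \<noteq> {}"
    have "\<not> directly_indecomposable (set_order {S \<in> D. S \<subseteq> e {n} \<union> e (X - {n})})"
      using ne by (intro ring_of_sets_not_directly_indecomposable ring_of_sets_D empty_in_D e_in_D)
        (simp_all add: e_Int e_empty e_eq_empty_iff)
    moreover have "e {n} \<union> e (X - {n}) = c"
      using n by (simp add: X e_Un insert_absorb)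
    ultimately show False using ind by simp
  qed
  then have "finite X"
    using finite_subset[of X "{_}"] by (cases "X = {}") blast+
  \<comment> \<open>A finite \<open>X\<close> is not in \<open>U\<close>, so \<open>c\<close> lacks
    0, the only number in which \<open>y\<close> exceeds \<open>x\<close>.\<close>
  then have "y \<inter> c \<subseteq> x"
    using infinite_mem by (subst triple_subset_iff) (auto simp: X x_def y_def)
  \<comment> \<open>\<open>T\<close> keeps only coordinate \<open>i\<close> of \<open>y\<close>. It
    lies below both \<open>c\<close> and \<open>y\<close>, hence below \<open>x\<close>,
    contradicting the choice of \<open>i\<close>.\<close>
  moreover obtain T where T: "T \<in> D" "f T = (f {})(i := f y i)"
    using upd[OF empty_in_D i fc[OF y i]] by blast
  have "T \<subseteq> c" using below[OF T(1)] T(2) by simp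
  moreover have "f T j \<sqsubseteq>\<^bsub>F j\<^esub> f y j" if "j \<in> I" for j
    using refl[OF y that] bot[OF that fc[OF y that]] by (cases "j = i") (simp_all add: T(2))
  then have "T \<subseteq> y" using le[OF T(1) y] by blast
  ultimately have "T \<subseteq> x" by blast
  then have "f T i \<sqsubseteq>\<^bsub>F i\<^esub> f x i" using le[OF T(1) x] i by blast
  then show False using nle T(2) by simp
qed

end

theorem mainTheorem2:
  shows "\<exists>D :: nat set gorder.
    complete_lattice D \<and> distributive_lattice D \<and>
    lattice_isomorphic D (inv_gorder D) \<and>
    complete_sublattice D (Cen D) \<and>
    atomistic (D\<lparr>carrier := Cen D\<rparr>) \<and>
    \<not> totally_decomposable D"
proof -
  obtain U :: "nat set set" where "free_ultrafilter U"
    using free_ultrafilter_exists[OF infinite_UNIV_nat] by blast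
  then interpret nat_free_ultrafilter U
    by (simp add: nat_free_ultrafilter_def)
  show ?thesis
  proof (intro exI conjI)
    show "complete_lattice (set_order D)" by (rule complete_lattice_D)
    show "distributive_lattice (set_order D)"
      by (rule ring_of_sets_distributive[OF ring_of_sets_D])
    show "lattice_isomorphic (set_order D) (inv_gorder (set_order D))" by (rule self_dual_D)
    show "complete_sublattice (set_order D) (Cen (set_order D))"
      by (rule complete_sublattice_Cen_D)
    show "atomistic ((set_order D)\<lparr>carrier := Cen (set_order D)\<rparr>)"
      using atomistic_Cen_D by simp
    show "\<not> totally_decomposable (set_order D)" by (rule not_totally_decomposable_D)
  qed
qed

end
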